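(* For every strongly connected pure $(d-1)$-dimensional simplicial complex with $n$ vertices and diameter $\delta$, there is a $(d-1)$-dimensional pseudo-manifold without boundary with $2n$ vertices and diameter at least $\delta+2$.
   Context: A pure simplicial complex of dimension $d-1$ on a vertex set $V$ is a family $C$ of $d$-element subsets of $V$, called facets; it has $n$ vertices when $|V|=n$. A ridge of $C$ is a $(d-1)$-element subset of some facet. The dual graph $G(C)$ has the facets as vertices, two facets being adjacent iff they share a ridge (i.e. differ in exactly one element). $C$ is strongly connected if $G(C)$ is connected; its diameter is the graph diameter of $G(C)$. A pseudo-manifold without boundary is a strongly connected pure complex in which every ridge is contained in exactly two facets.
   Formalization: The dimension d-1 is assumed to be at least 1; in dimension 0 the claim is false, since the only ridge is the empty set, so a pseudo-manifold without boundary has exactly two facets and diameter 1, less than δ+2. *)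

theory Defs
  imports "Graph_Theory.Graph_Theory"
begin

(* Complexes are represented by their set of facets. The parameter d is the number of vertices of
   a facet, so the dimension is d - 1. The ground set V may contain points that lie on no facet;
   the number of vertices is card V. *)
definition pure_complex :: "nat \<Rightarrow> 'a set \<Rightarrow> 'a set set \<Rightarrow> bool" where
  "pure_complex d V C \<longleftrightarrow> finite V \<and> (\<forall>F\<in>C. F \<subseteq> V \<and> card F = d)"

(* Meant for d > 0; the truncated subtraction then agrees with subtraction in the integers. *)
definition ridges :: "nat \<Rightarrow> 'a set set \<Rightarrow> 'a set set" where
  "ridges d C = {R. card R = d - 1 \<and> (\<exists>F\<in>C. R \<subseteq> F)}"

(* An undirected graph is represented by a symmetric loop-free digraph. *)
definition dual_graph :: "nat \<Rightarrow> 'a set set \<Rightarrow> 'a set pair_pre_digraph" where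
  "dual_graph d C =
     \<lparr> pverts = C,
       parcs = {(F, G). F \<in> C \<and> G \<in> C \<and> F \<noteq> G \<and> (\<exists>R\<in>ridges d C. R \<subseteq> F \<and> R \<subseteq> G)} \<rparr>"

lemma pair_bidirected_digraph_dual_graph: "pair_bidirected_digraph (dual_graph d C)"
  by unfold_locales (auto simp: dual_graph_def symmetric_def sym_def)

lemma wf_digraph_dual_graph: "wf_digraph (with_proj (dual_graph d C))"
  by unfold_locales (auto simp: dual_graph_def)

(* With all arc weights equal to 1, the weighted distance is the number of arcs of a shortest
   walk. *)
definition graph_diameter :: "('a, 'b) pre_digraph \<Rightarrow> ereal" where
  "graph_diameter G = (SUP (u, v) \<in> verts G \<times> verts G. wf_digraph.\<mu> G (\<lambda>_. 1) u v)"

definition complex_diameter :: "nat \<Rightarrow> 'a set set \<Rightarrow> ereal" where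
  "complex_diameter d C = graph_diameter (with_proj (dual_graph d C))"

(* Connected graphs are nonempty in Graph_Theory, so a strongly connected complex has a facet.
   The name is qualified because of topological connectedness. *)
definition strongly_connected_complex :: "nat \<Rightarrow> 'a set set \<Rightarrow> bool" where
  "strongly_connected_complex d C \<longleftrightarrow> Digraph_Component.connected (with_proj (dual_graph d C))"

definition pseudo_manifold_without_boundary :: "nat \<Rightarrow> 'a set \<Rightarrow> 'a set set \<Rightarrow> bool" where
  "pseudo_manifold_without_boundary d V C \<longleftrightarrow>
     pure_complex d V C \<and> strongly_connected_complex d C \<and>
     (\<forall>R\<in>ridges d C. card {F \<in> C. R \<subseteq> F} = 2)"

end

theory Submission
  imports Defs
begin

text \<open>
  A shortest path between two facets at maximal distance is a corridor \<open>F 0, \<dots>, F m\<close>: its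
  dual graph is an induced path. Replace every vertex \<open>v\<close> by a positive copy \<open>2 v\<close> and a negative
  copy \<open>2 v + 1\<close>. Lifting each \<open>F i\<close> in all \<open>2^d\<close> ways puts every lifted ridge in two facets for
  each \<open>F i\<close> containing it, so a ridge between consecutive facets lies in four. Keeping at an
  interior \<open>F i\<close> only the lifts in which the entering and the leaving vertex have equal signs, and
  at each end only those in which the one such vertex is positive, leaves exactly one facet on either
  side of such a ridge, and changes nothing over the ridges lying in a single \<open>F i\<close>.

  Each of the remaining lifts consists of a position \<open>i\<close> and \<open>d - 1\<close> free signs (\<open>d\<close> if \<open>m = 0\<close>),
  and a step changes either the position by one, keeping all signs, or a single sign. Going from one
  end to the other while changing all signs takes \<open>m + d - 1 \<ge> m + 2\<close> steps if \<open>d \<ge> 3\<close>. For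
  \<open>d = 2\<close> the corridor is a path with \<open>m + 2 \<le> n\<close> vertices, and the polygon with \<open>2 n\<close> vertices
  has diameter \<open>n\<close>.
\<close>

subsection \<open>Walks in the dual graph\<close>

abbreviation facet_adj :: "nat \<Rightarrow> 'a set set \<Rightarrow> ('a set \<times> 'a set) set" where
  "facet_adj d C \<equiv> parcs (dual_graph d C)"

lemma facet_adj_iff:
  "(F, G) \<in> facet_adj d C \<longleftrightarrow>
     F \<in> C \<and> G \<in> C \<and> F \<noteq> G \<and> (\<exists>R. card R = d - 1 \<and> R \<subseteq> F \<and> R \<subseteq> G)"
  by (auto simp: dual_graph_def ridges_def)

lemma sym_facet_adj: "sym (facet_adj d C)"
  by (auto simp: sym_def facet_adj_iff)

text \<open>The library notion uses the symmetric closure and walks confined to the vertex set. The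
  dual graph is already symmetric and its arcs have both ends in \<open>C\<close>, so plain
  reachability captures it.\<close>

lemma strongly_connected_complex_iff:
  "strongly_connected_complex d C \<longleftrightarrow> C \<noteq> {} \<and> (\<forall>F\<in>C. \<forall>G\<in>C. (F, G) \<in> (facet_adj d C)\<^sup>*)"
proof -
  have mk: "parcs (mk_symmetric (with_proj (dual_graph d C))) = facet_adj d C"
    using sym_facet_adj[of d C] by (auto simp: parcs_mk_symmetric sym_def)
  have "(F, G) \<in> rtrancl_on C (facet_adj d C) \<longleftrightarrow> F \<in> C \<and> (F, G) \<in> (facet_adj d C)\<^sup>*" for F G
  proof
    assume "(F, G) \<in> rtrancl_on C (facet_adj d C)"
    then show "F \<in> C \<and> (F, G) \<in> (facet_adj d C)\<^sup>*"
      by induction (auto intro: rtrancl_into_rtrancl)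
  next
    assume "F \<in> C \<and> (F, G) \<in> (facet_adj d C)\<^sup>*"
    then have "(F, G) \<in> (facet_adj d C)\<^sup>*" "F \<in> C" by auto
    then show "(F, G) \<in> rtrancl_on C (facet_adj d C)"
    proof induction
      case (step G H)
      then show ?case
        using rtrancl_on_into_rtrancl_on[of F G C "facet_adj d C" H] by (simp add: facet_adj_iff)
    qed auto
  qed
  moreover have "pverts (dual_graph d C) = C" by (simp add: dual_graph_def)
  ultimately show ?thesis
    by (auto simp: strongly_connected_complex_def Digraph_Component.connected_def
        strongly_connected_def reachable_def mk)
qed

lemma strongly_connected_complexI:
  assumes "F \<in> C" "\<And>G. G \<in> C \<Longrightarrow> (F, G) \<in> (facet_adj d C)\<^sup>*"
  shows "strongly_connected_complex d C"
  unfolding strongly_connected_complex_iff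
  using assms sym_rtrancl[OF sym_facet_adj, of d C] by (meson empty_iff rtrancl_trans symD)

text \<open>Together with its converse below, this lets distances be treated as exponents of the
  adjacency relation.\<close>

lemma relpow_facet_adj_awalk:
  assumes "(F, G) \<in> facet_adj d C ^^ k" "F \<in> C"
  shows "\<exists>p. pre_digraph.awalk (with_proj (dual_graph d C)) F p G \<and> length p = k"
  using assms
proof (induction k arbitrary: F)
  case 0
  then show ?case
    by (intro exI[of _ "[]"])
      (simp add: wf_digraph.awalk_Nil_iff[OF wf_digraph_dual_graph], simp add: dual_graph_def)
next
  case (Suc k)
  obtain H where H: "(F, H) \<in> facet_adj d C" "(H, G) \<in> facet_adj d C ^^ k"
    using Suc.prems(1) by (meson relpow_Suc_D2)
  then have "H \<in> C" by (simp add: facet_adj_iff)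
  with Suc.IH H(2) obtain p where
    "pre_digraph.awalk (with_proj (dual_graph d C)) H p G" "length p = k" by blast
  with H(1) show ?case
    by (intro exI[of _ "(F, H) # p"])
      (simp add: wf_digraph.awalk_Cons_iff[OF wf_digraph_dual_graph])
qed

lemma awalk_relpow_facet_adj:
  assumes "pre_digraph.awalk (with_proj (dual_graph d C)) F p G"
  shows "(F, G) \<in> facet_adj d C ^^ length p"
  using assms
proof (induction p arbitrary: F)
  case Nil
  then show ?case by (simp add: wf_digraph.awalk_Nil_iff[OF wf_digraph_dual_graph])
next
  case (Cons e p)
  then show ?case
    by (cases e)
      (auto simp: wf_digraph.awalk_Cons_iff[OF wf_digraph_dual_graph]
        simp del: relpow.simps intro: relpow_Suc_I2)
qed

lemma awalk_cost_unit:
  fixes p :: "('a set \<times> 'a set) list"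
  shows "wf_digraph.awalk_cost (\<lambda>_. 1) p = real (length p)"
  unfolding wf_digraph.awalk_cost_def[OF wf_digraph_dual_graph] by (simp add: sum_list_triv)

lemma facet_dist_le:
  assumes "(F, G) \<in> facet_adj d C ^^ k" "F \<in> C"
  shows "wf_digraph.\<mu> (with_proj (dual_graph d C)) (\<lambda>_. 1) F G \<le> ereal (real k)"
  using relpow_facet_adj_awalk[OF assms] wf_digraph.min_cost_le_walk_cost[OF wf_digraph_dual_graph]
  by (metis awalk_cost_unit)

lemma complex_diameter_ge:
  assumes "F \<in> C" "G \<in> C" "\<And>k. (F, G) \<in> facet_adj d C ^^ k \<Longrightarrow> n \<le> k"
  shows "ereal (real n) \<le> complex_diameter d C"
proof -
  have "ereal (real n) \<le> wf_digraph.\<mu> (with_proj (dual_graph d C)) (\<lambda>_. 1) F G"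
    unfolding wf_digraph.\<mu>_def[OF wf_digraph_dual_graph]
    by (intro INF_greatest) (use assms(3) awalk_relpow_facet_adj in \<open>force simp: awalk_cost_unit\<close>)
  also have "\<dots> \<le> complex_diameter d C"
    unfolding complex_diameter_def graph_diameter_def
    by (rule SUP_upper2[of "(F, G)"]) (use assms(1,2) in \<open>auto simp: dual_graph_def\<close>)
  finally show ?thesis .
qed

subsection \<open>Corridors\<close>

text \<open>Only intersection sizes occur, so the ambient complex can be forgotten and the vertices
  renamed injectively.\<close>

locale corridor =
  fixes d m :: nat and F :: "nat \<Rightarrow> 'a set"
  assumes d_gt_1: "1 < d"
    and card_facet: "i \<le> m \<Longrightarrow> card (F i) = d"
    and card_consecutive: "i < m \<Longrightarrow> card (F i \<inter> F (Suc i)) = d - 1"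
    and card_nonconsecutive: "Suc i < j \<Longrightarrow> j \<le> m \<Longrightarrow> card (F i \<inter> F j) < d - 1"

text \<open>A common ridge of two nonconsecutive facets would be a shortcut. Consecutive facets are
  distinct \<open>d\<close>-sets with a common ridge, which is then their whole
  intersection.\<close>

lemma shortest_path_corridor:
  assumes d: "1 < d" and C: "pure_complex d V C" and "u \<in> C" "(u, v) \<in> facet_adj d C ^^ m"
    and min: "\<And>k. (u, v) \<in> facet_adj d C ^^ k \<Longrightarrow> m \<le> k"
  obtains F where "corridor d m F" "\<And>i. i \<le> m \<Longrightarrow> F i \<in> C"
proof -
  obtain F where F: "F 0 = u" "F m = v" "\<And>i. i < m \<Longrightarrow> (F i, F (Suc i)) \<in> facet_adj d C"
    using assms(4) unfolding relpow_fun_conv by blast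
  have sub: "(F i, F (i + k)) \<in> facet_adj d C ^^ k" if "i + k \<le> m" for i k
    using that unfolding relpow_fun_conv by (intro exI[of _ "\<lambda>l. F (i + l)"]) (auto intro: F(3))
  have FC: "F i \<in> C" if "i \<le> m" for i
    using that F(3)[of "i - 1"] \<open>u \<in> C\<close> F(1) by (cases i) (auto simp: facet_adj_iff)
  have card_F: "card (F i) = d" "finite (F i)" if "i \<le> m" for i
    using FC[OF that] C d by (auto simp: pure_complex_def intro: finite_subset)
  \<comment> \<open>Splicing a shorter connection into the path would beat \<open>m\<close>. Below,
    \<open>k = 0\<close> gives distinctness and \<open>k = 1\<close> excludes common ridges.\<close>
  have short: "\<not> (F i, F j) \<in> facet_adj d C ^^ k" if "k + i < j" "j \<le> m" for i j k
  proof
    assume "(F i, F j) \<in> facet_adj d C ^^ k"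
    then have "(u, v) \<in> facet_adj d C ^^ (i + k + (m - j))"
      using sub[of 0 i] sub[of j "m - j"] that F(1,2) unfolding relpow_add by auto
    with min that show False by fastforce
  qed
  have "corridor d m F"
  proof
    fix i assume "i < m"
    then obtain R where R: "card R = d - 1" "R \<subseteq> F i \<inter> F (Suc i)" "F i \<noteq> F (Suc i)"
      using F(3) by (fastforce simp: facet_adj_iff)
    have "card (F i \<inter> F (Suc i)) \<noteq> d"
      using R(3) card_F[of i] card_F[of "Suc i"] \<open>i < m\<close>
      by (metis Suc_leI inf_le1 inf_le2 less_imp_le_nat card_subset_eq)
    moreover have "card (F i \<inter> F (Suc i)) \<le> d"
      using card_F[of i] \<open>i < m\<close> by (metis card_mono inf_le1 less_imp_le_nat)
    moreover have "d - 1 \<le> card (F i \<inter> F (Suc i))"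
      using R card_F[of i] \<open>i < m\<close> by (metis card_mono finite_Int less_imp_le_nat)
    ultimately show "card (F i \<inter> F (Suc i)) = d - 1" by linarith
  next
    fix i j assume ij: "Suc i < j" "j \<le> m"
    show "card (F i \<inter> F j) < d - 1"
    proof (rule ccontr)
      assume "\<not> card (F i \<inter> F j) < d - 1"
      then obtain R where "card R = d - 1" "R \<subseteq> F i \<inter> F j"
        by (meson not_less obtain_subset_with_card_n)
      moreover have "F i \<noteq> F j" using short[of 0 i j] ij by auto
      ultimately have "(F i, F j) \<in> facet_adj d C ^^ 1"
        using FC[of i] FC[of j] ij by (auto simp: facet_adj_iff)
      with short[of 1 i j] ij show False by simp
    qed
  qed (use d card_F in auto)
  with FC that show ?thesis by blast
qed

lemma diameter_corridor:
  assumes d: "1 < d" and C: "pure_complex d V C" "strongly_connected_complex d C"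
  obtains m F where "corridor d m F" "\<And>i. i \<le> m \<Longrightarrow> F i \<in> C"
    "complex_diameter d C \<le> ereal (real m)"
proof -
  let ?A = "facet_adj d C"
  define dist where "dist F G = (LEAST k. (F, G) \<in> ?A ^^ k)" for F G
  have conn: "(F, G) \<in> ?A\<^sup>*" if "F \<in> C" "G \<in> C" for F G
    using C(2) that by (auto simp: strongly_connected_complex_iff)
  have ne: "C \<noteq> {}" using C(2) by (auto simp: strongly_connected_complex_iff)
  have dist: "(F, G) \<in> ?A ^^ dist F G" if "F \<in> C" "G \<in> C" for F G
    using rtrancl_imp_relpow[OF conn[OF that]] unfolding dist_def by (auto intro: LeastI)
  have "finite C" using C(1) by (auto simp: pure_complex_def intro: finite_subset[of _ "Pow V"])
  \<comment> \<open>The maximum is attained because \<open>C\<close> is finite; a shortest path for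
    an extremal pair is the corridor.\<close>
  define m where "m = Max (case_prod dist ` (C \<times> C))"
  have fin: "finite (case_prod dist ` (C \<times> C))" using \<open>finite C\<close> by simp
  have "m \<in> case_prod dist ` (C \<times> C)"
    unfolding m_def by (rule Max_in[OF fin]) (use ne in auto)
  then obtain u v where uv: "u \<in> C" "v \<in> C" "m = dist u v" by auto
  have "m \<le> k" if "(u, v) \<in> ?A ^^ k" for k
    using that unfolding uv(3) dist_def by (rule Least_le)
  then obtain F where F: "corridor d m F" "\<And>i. i \<le> m \<Longrightarrow> F i \<in> C"
    using shortest_path_corridor[OF d C(1) uv(1)] dist[OF uv(1,2)] uv(3) by metis
  have "complex_diameter d C \<le> ereal (real m)"
    unfolding complex_diameter_def graph_diameter_def
  proof (rule SUP_least, clarify)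
    fix F G assume "F \<in> verts (with_proj (dual_graph d C))" "G \<in> verts (with_proj (dual_graph d C))"
    then have FG: "F \<in> C" "G \<in> C" by (auto simp: dual_graph_def)
    then have "dist F G \<le> m" unfolding m_def by (intro Max_ge[OF fin]) auto
    then show "wf_digraph.\<mu> (with_proj (dual_graph d C)) (\<lambda>_. 1) F G \<le> ereal (real m)"
      using facet_dist_le[OF dist[OF FG] FG(1)] by (metis ereal_less_eq(3) of_nat_mono order_trans)
  qed
  with F that show ?thesis by blast
qed

section \<open>Ridges, balanced sign patterns and height along a corridor\<close>

context corridor
begin

lemma finite_facet: "i \<le> m \<Longrightarrow> finite (F i)"
  using card_facet[of i] d_gt_1 card.infinite by fastforce

lemma common_ridge:
  assumes "i < j" "j \<le> m" "card Q = d - 1" "Q \<subseteq> F i" "Q \<subseteq> F j"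
  shows "j = Suc i" "Q = F i \<inter> F j"
proof -
  have fin: "finite (F i \<inter> F j)" using finite_facet[of i] assms by auto
  have le: "d - 1 \<le> card (F i \<inter> F j)" using card_mono[OF fin, of Q] assms by simp
  then show j: "j = Suc i" using card_nonconsecutive[of i j] assms by fastforce
  show "Q = F i \<inter> F j"
    using card_consecutive[of i] assms j by (intro card_subset_eq[OF fin]) auto
qed

text \<open>If two positions carried the same facet, any ridge of it would be common to both and
  hence, by \<open>common_ridge\<close>, equal to the whole facet, which has one element
  more.\<close>

lemma facet_eq_iff: "i \<le> m \<Longrightarrow> j \<le> m \<Longrightarrow> F i = F j \<longleftrightarrow> i = j"
proof (induction i j rule: linorder_wlog)
  case (le i j)
  show ?case
  proof (cases "i < j")
    case True
    obtain Q where Q: "Q \<subseteq> F i" "card Q = d - 1"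
      using obtain_subset_with_card_n[of "d - 1" "F i"] card_facet[OF le(2)] by auto
    then have "F i \<noteq> F j"
      using common_ridge[OF True le(3) Q(2)] card_facet[OF le(2)] d_gt_1 by auto
    with True show ?thesis by simp
  qed (use le in auto)
qed auto

text \<open>
  \<open>leaving i\<close> and \<open>entering i\<close> are the singletons of the vertices dropped after and added
  at \<open>F i\<close>; they are empty at the two ends of the corridor. Hence \<open>balanced\<close> makes the two
  vertices carry the same sign in the interior, and makes the one existing vertex positive at an end.
\<close>

definition leaving :: "nat \<Rightarrow> 'a set" where
  "leaving i = (if i < m then F i - F (Suc i) else {})"

definition entering :: "nat \<Rightarrow> 'a set" where
  "entering i = (if 0 < i then F i - F (i - 1) else {})"

definition balanced :: "nat \<Rightarrow> 'a set \<Rightarrow> bool" where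
  "balanced i S \<longleftrightarrow> S \<subseteq> F i \<and> (leaving i \<inter> S = {} \<longleftrightarrow> entering i \<inter> S = {})"

lemma card_leaving: "i < m \<Longrightarrow> card (leaving i) = 1"
  using card_facet[of i] card_consecutive[of i] finite_facet[of i] d_gt_1
  by (simp add: leaving_def card_Diff_subset_Int)

lemma card_entering: "0 < i \<Longrightarrow> i \<le> m \<Longrightarrow> card (entering i) = 1"
  using card_facet[of i] card_consecutive[of "i - 1"] finite_facet[of i] d_gt_1
  by (simp add: entering_def card_Diff_subset_Int Int_commute)

lemma leaving_eq:
  assumes "x \<in> leaving i"
  shows "i < m" "leaving i = {x}"
proof -
  show "i < m" using assms by (auto simp: leaving_def split: if_splits)
  then show "leaving i = {x}" using card_leaving assms by (metis card_1_singletonE singletonD)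
qed

lemma entering_eq:
  assumes "i \<le> m" "x \<in> entering i"
  shows "0 < i" "entering i = {x}"
proof -
  show "0 < i" using assms by (auto simp: entering_def split: if_splits)
  then show "entering i = {x}" using card_entering assms by (metis card_1_singletonE singletonD)
qed

text \<open>If the vertex that has just entered left at once, \<open>F (i - 1)\<close> and
  \<open>F (Suc i)\<close> would share a ridge.\<close>

lemma leaving_entering_disjoint:
  assumes "i \<le> m"
  shows "leaving i \<inter> entering i = {}"
proof (rule ccontr)
  assume ne: "leaving i \<inter> entering i \<noteq> {}"
  then have i: "0 < i" "i < m" by (auto simp: leaving_def entering_def split: if_splits)
  have "leaving i = entering i"
    using card_leaving[OF i(2)] card_entering[OF i(1) assms] ne
    by (auto simp: card_1_singleton_iff)
  then have "F i \<inter> F (Suc i) \<subseteq> F (i - 1)"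
    using i by (auto simp: leaving_def entering_def)
  then have "Suc i = Suc (i - 1)"
    using i card_consecutive[OF i(2)]
    by (intro common_ridge(1)[of _ _ "F i \<inter> F (Suc i)"]) auto
  with i show False by simp
qed

text \<open>Balance ties the sign of \<open>x\<close> to the signs on the rest of
  \<open>F i\<close>, so these extend in exactly one way. This is what leaves one facet on each side
  of an inner ridge.\<close>

lemma balanced_unique:
  assumes i: "i \<le> m" and x: "x \<in> leaving i \<union> entering i"
  obtains T where "{S. balanced i S \<and> (F i - {x}) \<inter> S = (F i - {x}) \<inter> S0} = {T}"
proof -
  have sub: "leaving i \<subseteq> F i" "entering i \<subseteq> F i" by (auto simp: leaving_def entering_def)
  \<comment> \<open>\<open>P\<close> is the other one of \<open>leaving i\<close> and
    \<open>entering i\<close>. It may be empty, and then \<open>x\<close> must be positive.\<close>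
  obtain P where P: "P \<subseteq> F i - {x}"
    and bal: "\<And>S. balanced i S \<longleftrightarrow> S \<subseteq> F i \<and> (x \<in> S \<longleftrightarrow> P \<inter> S \<noteq> {})"
  proof (cases "x \<in> leaving i")
    case True
    note eq = leaving_eq(2)[OF True]
    have "entering i \<subseteq> F i - {x}" using sub(2) leaving_entering_disjoint[OF i] True by blast
    then show ?thesis by (rule that) (auto simp: balanced_def eq)
  next
    case False
    with x have True: "x \<in> entering i" by blast
    note eq = entering_eq(2)[OF i True]
    have "leaving i \<subseteq> F i - {x}" using sub(1) False by blast
    then show ?thesis by (rule that) (auto simp: balanced_def eq)
  qed
  let ?T = "(F i - {x}) \<inter> S0"
  have xF: "x \<in> F i" using x sub by blast
  let ?U = "if P \<inter> ?T = {} then ?T else insert x ?T"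
  have "balanced i ?U \<and> (F i - {x}) \<inter> ?U = ?T" using P xF by (auto simp: bal)
  moreover have "S = ?U" if S: "balanced i S \<and> (F i - {x}) \<inter> S = ?T" for S
  proof -
    have "P \<inter> S = P \<inter> ?T" using P S by blast
    then show ?thesis using S by (auto simp: bal)
  qed
  ultimately have "{S. balanced i S \<and> (F i - {x}) \<inter> S = ?T} = {?U}" by blast
  then show ?thesis by (rule that)
qed

text \<open>A potential bounding from below the distance to the all-positive lift of
  \<open>F 0\<close>: the position plus the number of negative vertices, where the tied leaving and
  entering vertices count once.\<close>

definition height :: "nat \<Rightarrow> 'a set \<Rightarrow> nat" where
  "height i S = i + card (S - leaving i)"

text \<open>
  The number of negative vertices shared with the next facet equals the number shared with the
  previous facet, so passing between consecutive facets of the corridor changes the height by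
  exactly 1, just as flipping one sign does.
\<close>

lemma height_entering:
  assumes "i \<le> m" "balanced i S"
  shows "height i S = i + card (S - entering i)"
proof -
  have "finite S" using assms finite_facet[of i] by (auto simp: balanced_def intro: finite_subset)
  have "card (S \<inter> leaving i) = card (S \<inter> entering i)"
  proof (cases "leaving i \<inter> S = {}")
    case True
    with assms have "entering i \<inter> S = {}" by (simp add: balanced_def)
    with True show ?thesis by (simp add: Int_commute)
  next
    case False
    with assms have "entering i \<inter> S \<noteq> {}" by (simp add: balanced_def)
    with False have "card (leaving i) = 1" "card (entering i) = 1"
      using assms card_leaving[of i] card_entering[of i]
      by (auto simp: leaving_def entering_def split: if_splits)
    with False \<open>entering i \<inter> S \<noteq> {}\<close> show ?thesis
      by (auto simp: card_1_singleton_iff)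
  qed
  with \<open>finite S\<close> show ?thesis by (simp add: height_def card_Diff_subset_Int)
qed

lemma height_lipschitz:
  assumes i: "i \<le> m" and j: "j \<le> m" and S: "balanced i S" and T: "balanced j T"
    and Q: "card Q = d - 1" "Q \<subseteq> F i" "Q \<subseteq> F j" "Q \<inter> S = Q \<inter> T"
  shows "height i S \<le> height j T + 1"
proof (cases i j rule: linorder_cases)
  case less
  have j': "j = Suc i" "Q = F i \<inter> F j" using common_ridge[OF less j Q(1-3)] by auto
  \<comment> \<open>Both heights now count the negative vertices of the common ridge, and only the
    positions differ.\<close>
  then have "S - leaving i = Q \<inter> S" "T - entering j = Q \<inter> T"
    using S T j by (auto simp: leaving_def entering_def balanced_def)
  then show ?thesis using height_entering[OF j T] Q(4) j'(1) by (simp add: height_def)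
next
  case greater
  have i': "i = Suc j" "Q = F j \<inter> F i" using common_ridge[OF greater i Q(1,3,2)] by auto
  then have "T - leaving j = Q \<inter> T" "S - entering i = Q \<inter> S"
    using S T i by (auto simp: leaving_def entering_def balanced_def)
  then show ?thesis using height_entering[OF i S] Q(4) i'(1) by (simp add: height_def)
next
  case equal
  \<comment> \<open>At equal positions the sign sets can differ only at the single vertex outside
    \<open>Q\<close>.\<close>
  have "card (F i - Q) = 1"
    using card_facet[OF i] Q d_gt_1 finite_facet[OF i]
    by (simp add: card_Diff_subset finite_subset)
  then obtain x where "F i - Q = {x}" by (auto simp: card_1_singleton_iff)
  then have "S - leaving i \<subseteq> insert x (T - leaving j)"
    using equal S Q(4) by (auto simp: balanced_def)
  moreover have "finite (T - leaving j)"
    using T finite_facet[OF j] by (auto simp: balanced_def intro: finite_subset)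
  ultimately have "card (S - leaving i) \<le> Suc (card (T - leaving j))"
    using card_mono[of "insert x (T - leaving j)" "S - leaving i"]
    by (simp add: card_insert_if split: if_splits)
  with equal show ?thesis by (simp add: height_def)
qed

end

subsection \<open>Doubling a corridor\<close>

text \<open>\<open>S\<close> is the set of negative vertices. A lifted point \<open>x\<close> has
  underlying vertex \<open>x div 2\<close>, and its parity is the sign.\<close>

definition signed_lift :: "nat set \<Rightarrow> nat set \<Rightarrow> nat set" where
  "signed_lift Q S = (\<lambda>v. if v \<in> S then 2 * v + 1 else 2 * v) ` Q"

lemma inj_on_sign: "inj_on (\<lambda>v::nat. if v \<in> S then 2 * v + 1 else 2 * v) Q"
  by (rule inj_on_inverseI[where g = "\<lambda>x. x div 2"]) simp

lemma card_signed_lift [simp]: "card (signed_lift Q S) = card Q"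
  unfolding signed_lift_def by (rule card_image[OF inj_on_sign])

lemma signed_lift_mem_iff:
  "x \<in> signed_lift Q S \<longleftrightarrow> x div 2 \<in> Q \<and> (odd x \<longleftrightarrow> x div 2 \<in> S)"
proof
  assume "x div 2 \<in> Q \<and> (odd x \<longleftrightarrow> x div 2 \<in> S)"
  then show "x \<in> signed_lift Q S"
    unfolding signed_lift_def by (intro image_eqI[of _ _ "x div 2"]) auto
qed (auto simp: signed_lift_def)

lemma signed_lift_subset_iff:
  "signed_lift Q S \<subseteq> signed_lift Q' S' \<longleftrightarrow> Q \<subseteq> Q' \<and> Q \<inter> S = Q \<inter> S'"
proof
  assume sub: "signed_lift Q S \<subseteq> signed_lift Q' S'"
  have "v \<in> Q' \<and> (v \<in> S \<longleftrightarrow> v \<in> S')" if "v \<in> Q" for v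
  proof -
    let ?x = "if v \<in> S then 2 * v + 1 else 2 * v"
    have "?x \<in> signed_lift Q S" using that by (auto simp: signed_lift_def)
    with sub have "?x \<in> signed_lift Q' S'" by blast
    then show ?thesis by (auto simp: signed_lift_mem_iff split: if_splits)
  qed
  then show "Q \<subseteq> Q' \<and> Q \<inter> S = Q \<inter> S'" by blast
qed (auto simp: signed_lift_mem_iff)

lemma signed_lift_eq_iff:
  "signed_lift Q S = signed_lift Q' S' \<longleftrightarrow> Q = Q' \<and> Q \<inter> S = Q \<inter> S'"
  using signed_lift_subset_iff[of Q S Q' S'] signed_lift_subset_iff[of Q' S' Q S] by blast

lemma subset_signed_lift:
  assumes "R \<subseteq> signed_lift Q S"
  obtains P where "P \<subseteq> Q" "R = signed_lift P S"
  using assms unfolding signed_lift_def subset_image_iff by blast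

section \<open>The doubled corridor and its ridges\<close>

locale nat_corridor = corridor d m F for d m :: nat and F :: "nat \<Rightarrow> nat set"
begin

definition double :: "nat set set" where
  "double = {signed_lift (F i) S |i S. i \<le> m \<and> balanced i S}"

lemma doubleI: "i \<le> m \<Longrightarrow> balanced i S \<Longrightarrow> signed_lift (F i) S \<in> double"
  by (auto simp: double_def)

lemma facet_adj_doubleI:
  assumes "i \<le> m" "j \<le> m" "balanced i S" "balanced j T"
    and "card Q = d - 1" "Q \<subseteq> F i" "Q \<subseteq> F j" "Q \<inter> S = Q \<inter> T" "i \<noteq> j \<or> S \<noteq> T"
  shows "(signed_lift (F i) S, signed_lift (F j) T) \<in> facet_adj d double"
proof -
  have "signed_lift (F i) S \<noteq> signed_lift (F j) T"
    using assms by (auto simp: signed_lift_eq_iff facet_eq_iff balanced_def)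
  moreover have "signed_lift Q S \<subseteq> signed_lift (F i) S" "signed_lift Q S \<subseteq> signed_lift (F j) T"
    using assms by (auto simp: signed_lift_subset_iff)
  ultimately show ?thesis
    using assms unfolding facet_adj_iff by (metis card_signed_lift doubleI)
qed

lemma facet_adj_doubleE:
  assumes "(G, H) \<in> facet_adj d double"
  obtains i j S T Q where "i \<le> m" "j \<le> m" "balanced i S" "balanced j T"
    "G = signed_lift (F i) S" "H = signed_lift (F j) T"
    "card Q = d - 1" "Q \<subseteq> F i" "Q \<subseteq> F j" "Q \<inter> S = Q \<inter> T"
proof -
  from assms have "G \<in> double" "H \<in> double" "\<exists>R. card R = d - 1 \<and> R \<subseteq> G \<and> R \<subseteq> H"
    by (simp_all add: facet_adj_iff)
  then obtain i S j T R where *: "i \<le> m" "j \<le> m" "balanced i S" "balanced j T"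
    "G = signed_lift (F i) S" "H = signed_lift (F j) T" "card R = d - 1" "R \<subseteq> G" "R \<subseteq> H"
    unfolding double_def by blast
  moreover from * obtain Q where "Q \<subseteq> F i" "R = signed_lift Q S"
    using subset_signed_lift by metis
  ultimately show ?thesis
    using that[of i j S T Q] by (auto simp: signed_lift_subset_iff)
qed

text \<open>Sorting the facets by position reduces counting them to two questions: which
  \<open>F j\<close> contain \<open>Q\<close>, and how many balanced sign sets extend the given
  signs.\<close>

lemma double_over_ridge:
  "{G \<in> double. signed_lift Q S \<subseteq> G} =
     (\<Union>j\<in>{j. j \<le> m \<and> Q \<subseteq> F j}. signed_lift (F j) ` {T. balanced j T \<and> Q \<inter> T = Q \<inter> S})"
    (is "?L = ?R")
proof
  show "?L \<subseteq> ?R"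
  proof
    fix G assume "G \<in> ?L"
    then obtain j T where "j \<le> m" "balanced j T" "G = signed_lift (F j) T" "Q \<subseteq> F j" "Q \<inter> T = Q \<inter> S"
      by (force simp: double_def signed_lift_subset_iff)
    then show "G \<in> ?R" by blast
  qed
  have "signed_lift Q S \<subseteq> signed_lift (F j) T" if "Q \<subseteq> F j" "Q \<inter> T = Q \<inter> S" for j T
    using that by (simp add: signed_lift_subset_iff)
  then show "?R \<subseteq> ?L" by (auto intro: doubleI)
qed

text \<open>Only two positions contain the ridge. The vertex missing from it is leaving at the first
  and entering at the second, so \<open>balanced_unique\<close> gives one facet at each.\<close>

lemma card_double_over_inner_ridge:
  assumes "k < m"
  shows "card {G \<in> double. signed_lift (F k \<inter> F (Suc k)) S \<subseteq> G} = 2"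
proof -
  let ?Q = "F k \<inter> F (Suc k)"
  have Q: "card ?Q = d - 1" by (rule card_consecutive[OF assms])
  have js: "{j. j \<le> m \<and> ?Q \<subseteq> F j} = {k, Suc k}"
  proof -
    have "j = k \<or> j = Suc k" if "j \<le> m" "?Q \<subseteq> F j" for j
    proof (rule ccontr)
      assume "\<not> (j = k \<or> j = Suc k)"
      then have "j < k \<or> Suc k < j" by linarith
      then show False
        using common_ridge(1)[OF _ _ Q, of j "Suc k"] common_ridge(1)[OF _ _ Q, of k j] that assms
        by auto
    qed
    with assms show ?thesis by auto
  qed
  obtain x where x: "leaving k = {x}"
    using card_leaving[OF assms] by (auto simp: card_1_singleton_iff)
  obtain y where y: "entering (Suc k) = {y}"
    using card_entering[of "Suc k"] assms by (auto simp: card_1_singleton_iff)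
  have "F k - {x} = ?Q" using x assms by (auto simp: leaving_def)
  with x assms obtain T where T: "{T. balanced k T \<and> ?Q \<inter> T = ?Q \<inter> S} = {T}"
    using balanced_unique[of k x S thesis] by simp
  have "F (Suc k) - {y} = ?Q" using y by (auto simp: entering_def)
  with y assms obtain T' where T': "{T. balanced (Suc k) T \<and> ?Q \<inter> T = ?Q \<inter> S} = {T'}"
    using balanced_unique[of "Suc k" y S thesis] by simp
  have "F k \<noteq> F (Suc k)" using assms by (simp add: facet_eq_iff)
  then show ?thesis
    unfolding double_over_ridge js UN_insert UN_empty T T' by (simp add: signed_lift_eq_iff)
qed

text \<open>Only position \<open>i\<close> contains the ridge, and balance does not constrain the
  sign of \<open>x\<close>: the two facets are the two choices of that sign.\<close>

lemma card_double_over_boundary_ridge: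
  assumes i: "i \<le> m" and x: "x \<in> F i" "x \<notin> leaving i" "x \<notin> entering i"
    and S: "balanced i S"
  shows "card {G \<in> double. signed_lift (F i - {x}) S \<subseteq> G} = 2"
proof -
  let ?Q = "F i - {x}"
  let ?T = "?Q \<inter> S"
  have Q: "card ?Q = d - 1" using card_facet[OF i] x by simp
  have js: "{j. j \<le> m \<and> ?Q \<subseteq> F j} = {i}"
  proof -
    have "j = i" if "j \<le> m" "?Q \<subseteq> F j" for j
    proof (cases i j rule: linorder_cases)
      case less
      \<comment> \<open>A neighbouring facet containing \<open>?Q\<close> would meet
        \<open>F i\<close> exactly in \<open>?Q\<close>, yet it also contains
        \<open>x\<close>.\<close>
      have "j = Suc i" "?Q = F i \<inter> F j" using common_ridge[OF less that(1) Q] that(2) by auto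
      moreover have "x \<in> F (Suc i)" using x less that(1) by (simp add: leaving_def)
      ultimately show ?thesis using x(1) by blast
    next
      case greater
      have "i = Suc j" "?Q = F j \<inter> F i" using common_ridge[OF greater i Q] that(2) by auto
      moreover have "x \<in> F (i - 1)" using x greater by (simp add: entering_def)
      ultimately show ?thesis using x(1) by auto
    qed auto
    with i show ?thesis by auto
  qed
  have sub: "leaving i \<subseteq> ?Q" "entering i \<subseteq> ?Q"
    using x by (auto simp: leaving_def entering_def)
  have bal: "balanced i T" if T: "?Q \<inter> T = ?T" "T \<subseteq> F i" for T
  proof -
    have "leaving i \<inter> T = leaving i \<inter> S" "entering i \<inter> T = entering i \<inter> S"
      using sub T(1) by blast+
    with S T(2) show ?thesis by (simp add: balanced_def)
  qed
  have *: "{T. balanced i T \<and> ?Q \<inter> T = ?T} = {?T, insert x ?T}"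
  proof
    show "{T. balanced i T \<and> ?Q \<inter> T = ?T} \<subseteq> {?T, insert x ?T}"
    proof
      fix T assume "T \<in> {T. balanced i T \<and> ?Q \<inter> T = ?T}"
      then have "T \<subseteq> F i" "?Q \<inter> T = ?T" by (auto simp: balanced_def)
      then have "T = (if x \<in> T then insert x ?T else ?T)" by auto
      then show "T \<in> {?T, insert x ?T}" by (metis insertI1 insertI2)
    qed
    have "balanced i ?T" "balanced i (insert x ?T)"
      by (rule bal; use x(1) in blast)+
    then show "{?T, insert x ?T} \<subseteq> {T. balanced i T \<and> ?Q \<inter> T = ?T}" by blast
  qed
  have "signed_lift (F i) ?T \<noteq> signed_lift (F i) (insert x ?T)"
    using x by (auto simp: signed_lift_eq_iff)
  then show ?thesis
    unfolding double_over_ridge js UN_insert UN_empty * by simp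
qed

lemma pure_complex_double:
  assumes "\<And>i. i \<le> m \<Longrightarrow> F i \<subseteq> {..<n}"
  shows "pure_complex d {..<2 * n} double"
proof -
  have "x < 2 * n" if "i \<le> m" "x \<in> signed_lift (F i) S" for i S x
    using assms[OF that(1)] that(2) by (auto simp: signed_lift_mem_iff)
  then show ?thesis by (auto simp: pure_complex_def double_def card_facet)
qed

lemma card_double_over_ridge:
  assumes "R \<in> ridges d double"
  shows "card {G \<in> double. R \<subseteq> G} = 2"
proof -
  obtain i S where iS: "i \<le> m" "balanced i S" "R \<subseteq> signed_lift (F i) S" and R: "card R = d - 1"
    using assms by (auto simp: ridges_def double_def)
  then obtain Q where Q: "Q \<subseteq> F i" "R = signed_lift Q S" using subset_signed_lift by metis
  have "card (F i - Q) = 1"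
    using card_facet[OF iS(1)] Q R d_gt_1 finite_facet[OF iS(1)]
    by (simp add: card_Diff_subset finite_subset)
  then obtain x where x: "F i - Q = {x}" by (auto simp: card_1_singleton_iff)
  then have Qx: "Q = F i - {x}" "x \<in> F i" using Q(1) by auto
  consider "x \<in> leaving i" | "x \<in> entering i" | "x \<notin> leaving i" "x \<notin> entering i" by blast
  then show ?thesis
  proof cases
    case 1
    note leaving_eq[OF 1]
    moreover from this have "Q = F i \<inter> F (Suc i)" using Qx by (auto simp: leaving_def)
    ultimately show ?thesis using card_double_over_inner_ridge Q(2) by simp
  next
    case 2
    note entering_eq[OF iS(1) 2]
    moreover from this have "Q = F (i - 1) \<inter> F (Suc (i - 1))" using Qx by (auto simp: entering_def)
    ultimately show ?thesis
      using card_double_over_inner_ridge[of "i - 1" S] iS(1) unfolding Q(2) by simp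
  next
    case 3
    from card_double_over_boundary_ridge[OF iS(1) Qx(2) this iS(2)] show ?thesis
      unfolding Q(2) Qx(1) .
  qed
qed

section \<open>Strong connectedness and diameter of the double\<close>

lemma balanced_empty: "balanced i {}"
  by (simp add: balanced_def)

text \<open>At position 0 the negative signs are switched on one by one; at later positions one
  steps back across the ridge to the previous facet, keeping the signs on it.\<close>

lemma double_reachable:
  assumes "i \<le> m" "balanced i S"
  shows "(signed_lift (F 0) {}, signed_lift (F i) S) \<in> (facet_adj d double)\<^sup>*"
  using assms
proof (induction i arbitrary: S)
  case 0
  have "finite S" using 0 finite_facet[of 0] by (auto simp: balanced_def intro: finite_subset)
  then show ?case using 0(2)
  proof (induction S)
    case (insert x S)
    \<comment> \<open>Since \<open>entering 0\<close> is empty, balance says that the leaving vertex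
      is positive, which survives passing to a subset.\<close>
    then have S: "balanced 0 S" and x: "x \<in> F 0" by (auto simp: balanced_def entering_def)
    have "(signed_lift (F 0) S, signed_lift (F 0) (insert x S)) \<in> facet_adj d double"
      by (rule facet_adj_doubleI[where Q = "F 0 - {x}"])
        (use insert S x card_facet[of 0] in auto)
    with insert.IH[OF S] show ?case by (rule rtrancl_into_rtrancl)
  qed simp
next
  case (Suc i)
  let ?Q = "F i \<inter> F (Suc i)"
  have im: "i < m" using Suc.prems by simp
  obtain x where x: "leaving i = {x}"
    using card_leaving[OF im] by (auto simp: card_1_singleton_iff)
  have "F i - {x} = ?Q" using x im by (auto simp: leaving_def)
  with x im obtain T where "{T. balanced i T \<and> ?Q \<inter> T = ?Q \<inter> S} = {T}"
    using balanced_unique[of i x S thesis] by simp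
  then have T: "balanced i T" "?Q \<inter> T = ?Q \<inter> S" by blast+
  have "(signed_lift (F i) T, signed_lift (F (Suc i)) S) \<in> facet_adj d double"
    by (rule facet_adj_doubleI[where Q = ?Q])
      (use T Suc.prems im card_consecutive[OF im] in auto)
  with Suc.IH[OF _ T(1)] im show ?case by (meson less_imp_le_nat rtrancl_into_rtrancl)
qed

lemma strongly_connected_double: "strongly_connected_complex d double"
proof (rule strongly_connected_complexI)
  show "signed_lift (F 0) {} \<in> double" by (simp add: doubleI balanced_empty)
next
  fix G assume "G \<in> double"
  then obtain i S where "i \<le> m" "balanced i S" "G = signed_lift (F i) S"
    unfolding double_def by blast
  then show "(signed_lift (F 0) {}, G) \<in> (facet_adj d double)\<^sup>*"
    by (simp add: double_reachable)
qed

text \<open>The height starts at 0 and, by \<open>height_lipschitz\<close>, grows by at most 1 per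
  step.\<close>

lemma height_le_dist:
  assumes "(signed_lift (F 0) {}, signed_lift (F i) S) \<in> facet_adj d double ^^ k"
    and "i \<le> m" "balanced i S"
  shows "height i S \<le> k"
  using assms
proof (induction k arbitrary: i S)
  case 0
  then have "i = 0" "S = {}"
    by (auto simp: signed_lift_eq_iff facet_eq_iff balanced_def)
  then show ?case by (simp add: height_def)
next
  case (Suc k)
  then obtain G where G: "(signed_lift (F 0) {}, G) \<in> facet_adj d double ^^ k"
    "(G, signed_lift (F i) S) \<in> facet_adj d double" by auto
  obtain j l T S' Q where *: "j \<le> m" "l \<le> m" "balanced j T" "balanced l S'"
    "G = signed_lift (F j) T" "signed_lift (F i) S = signed_lift (F l) S'"
    "card Q = d - 1" "Q \<subseteq> F j" "Q \<subseteq> F l" "Q \<inter> T = Q \<inter> S'"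
    by (rule facet_adj_doubleE[OF G(2)])
  have "F i = F l" "F i \<inter> S = F i \<inter> S'" using *(6) unfolding signed_lift_eq_iff by blast+
  moreover from this(1) have "l = i" using *(2) Suc.prems(2) by (simp add: facet_eq_iff)
  ultimately have "l = i" "S' = S" using *(4) Suc.prems(3) by (auto simp: balanced_def)
  with * have "height i S \<le> height j T + 1"
    using height_lipschitz[OF Suc.prems(2) *(1) Suc.prems(3) *(3,7)] by simp
  also have "height j T \<le> k" using Suc.IH G(1) * by simp
  finally show ?case by simp
qed

lemma diameter_double:
  assumes "d > 2 \<or> m = 0"
  shows "ereal (real (m + 2)) \<le> complex_diameter d double"
proof -
  \<comment> \<open>All signs are negative except that of the entering vertex, which balance forces
    to be positive at the end. For \<open>m = 0\<close> there is no such vertex and all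
    \<open>d\<close> signs are negative.\<close>
  let ?S = "F m - entering m"
  have lv: "leaving m = {}" by (simp add: leaving_def)
  then have bal: "balanced m ?S" by (auto simp: balanced_def)
  have "m + 2 \<le> height m ?S"
  proof (cases "m = 0")
    case True
    then have "?S = F m" by (simp add: entering_def)
    then show ?thesis using d_gt_1 card_facet[of m] by (simp only: height_def lv) simp
  next
    case False
    have "?S = F (m - 1) \<inter> F (Suc (m - 1))" using False by (auto simp: entering_def)
    then have "card ?S = d - 1" using card_consecutive[of "m - 1"] False by simp
    then show ?thesis using assms False by (simp add: height_def lv)
  qed
  then have "m + 2 \<le> k"
    if "(signed_lift (F 0) {}, signed_lift (F m) ?S) \<in> facet_adj d double ^^ k" for k
    using height_le_dist[OF that _ bal] by simp
  then show ?thesis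
    by (intro complex_diameter_ge[OF doubleI[OF _ balanced_empty] doubleI[OF _ bal]]) auto
qed

end

subsection \<open>Polygons\<close>

definition polygon_edge :: "nat \<Rightarrow> nat \<Rightarrow> nat set" where
  "polygon_edge N i = {i, if Suc i = N then 0 else Suc i}"

definition polygon :: "nat \<Rightarrow> nat set set" where
  "polygon N = polygon_edge N ` {..<N}"

text \<open>The bound on \<open>N\<close> excludes the two-gon, whose two edges coincide.\<close>

lemma polygon_edge_eq_iff:
  "3 \<le> N \<Longrightarrow> i < N \<Longrightarrow> j < N \<Longrightarrow> polygon_edge N i = polygon_edge N j \<longleftrightarrow> i = j"
  by (auto simp: polygon_edge_def doubleton_eq_iff split: if_splits)

lemma polygon_edgeI: "i < N \<Longrightarrow> polygon_edge N i \<in> polygon N"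
  by (simp add: polygon_def)

lemma pure_complex_polygon: "2 \<le> N \<Longrightarrow> pure_complex 2 {..<N} (polygon N)"
  by (auto simp: pure_complex_def polygon_def polygon_edge_def card_insert_if)

lemma card_polygon_over_vertex:
  assumes "3 \<le> N" "R \<in> ridges 2 (polygon N)"
  shows "card {G \<in> polygon N. R \<subseteq> G} = 2"
proof -
  obtain j where R: "R = {j}" "j < N"
    using assms by (auto simp: ridges_def polygon_def polygon_edge_def card_1_singleton_iff
        split: if_splits)
  \<comment> \<open>The cyclic predecessor of \<open>j\<close>: the edges at \<open>j\<close> are
    those numbered \<open>j\<close> and \<open>p\<close>.\<close>
  define p where "p = (if j = 0 then N - 1 else j - 1)"
  have p: "p < N" "p \<noteq> j" using assms(1) R(2) by (auto simp: p_def)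
  have "j \<in> polygon_edge N i \<longleftrightarrow> i \<in> {j, p}" if "i < N" for i
    using that R(2) by (auto simp: polygon_edge_def p_def)
  then have "{G \<in> polygon N. R \<subseteq> G} = polygon_edge N ` {j, p}"
    using R p(1) by (auto simp: polygon_def)
  then show ?thesis using polygon_edge_eq_iff[OF assms(1) R(2) p(1)] p(2) by auto
qed

lemma strongly_connected_polygon:
  assumes "3 \<le> N"
  shows "strongly_connected_complex 2 (polygon N)"
proof (rule strongly_connected_complexI)
  show "polygon_edge N 0 \<in> polygon N" using assms by (simp add: polygon_edgeI)
  have "(polygon_edge N 0, polygon_edge N i) \<in> (facet_adj 2 (polygon N))\<^sup>*" if "i < N" for i
    using that
  proof (induction i)
    case (Suc i)
    have "(polygon_edge N i, polygon_edge N (Suc i)) \<in> facet_adj 2 (polygon N)"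
      unfolding facet_adj_iff
      using Suc.prems assms
      by (auto simp: polygon_edgeI polygon_edge_eq_iff intro!: exI[of _ "{Suc i}"])
        (simp_all add: polygon_edge_def)
    with Suc show ?case by (meson Suc_lessD rtrancl_into_rtrancl)
  qed simp
  then show "(polygon_edge N 0, G) \<in> (facet_adj 2 (polygon N))\<^sup>*" if "G \<in> polygon N" for G
    using that by (auto simp: polygon_def)
qed

text \<open>The cyclic distance \<open>min i (N - i)\<close> changes by at most 1 between edges with
  a common vertex.\<close>

lemma polygon_dist_ge:
  assumes "(polygon_edge N 0, polygon_edge N i) \<in> facet_adj 2 (polygon N) ^^ k"
    and "i < N" "3 \<le> N"
  shows "min i (N - i) \<le> k"
  using assms(1,2)
proof (induction k arbitrary: i)
  case 0
  then have "polygon_edge N 0 = polygon_edge N i" by simp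
  then show ?case using polygon_edge_eq_iff[OF assms(3), of 0 i] 0 assms(3) by simp
next
  case (Suc k)
  then obtain G where G: "(polygon_edge N 0, G) \<in> facet_adj 2 (polygon N) ^^ k"
    "(G, polygon_edge N i) \<in> facet_adj 2 (polygon N)" by auto
  from G(2) obtain j R where j: "j < N" "G = polygon_edge N j" and
    R: "card R = 1" "R \<subseteq> polygon_edge N j" "R \<subseteq> polygon_edge N i"
    by (auto simp: facet_adj_iff polygon_def)
  then obtain x where "x \<in> polygon_edge N j" "x \<in> polygon_edge N i"
    by (auto simp: card_1_singleton_iff)
  then have "min i (N - i) \<le> min j (N - j) + 1"
    using j(1) Suc.prems(2) by (auto simp: polygon_edge_def split: if_splits)
  also have "min j (N - j) \<le> k" using Suc.IH[of j] G(1) j by simp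
  finally show ?case by simp
qed

lemma diameter_polygon:
  assumes "2 \<le> n"
  shows "ereal (real n) \<le> complex_diameter 2 (polygon (2 * n))"
proof (rule complex_diameter_ge)
  show "polygon_edge (2 * n) 0 \<in> polygon (2 * n)" "polygon_edge (2 * n) n \<in> polygon (2 * n)"
    using assms by (auto intro: polygon_edgeI)
  show "n \<le> k"
    if "(polygon_edge (2 * n) 0, polygon_edge (2 * n) n) \<in> facet_adj 2 (polygon (2 * n)) ^^ k" for k
    using polygon_dist_ge[OF that] assms by simp
qed

subsection \<open>The theorem\<close>

text \<open>For \<open>d = 2\<close> nonconsecutive edges are disjoint, so each new edge meets the
  earlier ones in a single vertex and adds exactly one.\<close>

lemma (in corridor) card_Union_facets:
  assumes "d = 2" "k \<le> m"
  shows "k + 2 \<le> card (\<Union>i\<le>k. F i)"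
  using assms(2)
proof (induction k)
  case 0
  then show ?case using card_facet[of 0] assms(1) by simp
next
  case (Suc k)
  let ?U = "\<Union>i\<le>k. F i"
  have fin: "finite ?U" using finite_facet Suc.prems by auto
  have "F i \<inter> F (Suc k) = {}" if "i < k" for i
    using card_nonconsecutive[of i "Suc k"] finite_facet[of i] that Suc.prems assms(1) by simp
  then have "F (Suc k) \<inter> ?U = F k \<inter> F (Suc k)" by (auto simp: le_less disjoint_iff)
  then have "card (F (Suc k) - ?U) = 1"
    using card_facet[of "Suc k"] card_consecutive[of k] finite_facet[of "Suc k"] Suc.prems assms(1)
    by (simp add: card_Diff_subset_Int)
  moreover have "card (?U \<union> (F (Suc k) - ?U)) = card ?U + card (F (Suc k) - ?U)"
    using fin finite_facet[of "Suc k"] Suc.prems by (intro card_Un_disjoint) auto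
  moreover have "(\<Union>i\<le>Suc k. F i) = ?U \<union> (F (Suc k) - ?U)" by (auto simp: atMost_Suc)
  ultimately show ?case using Suc by simp
qed

lemma (in corridor) corridor_image:
  assumes "inj_on g V" "\<And>i. i \<le> m \<Longrightarrow> F i \<subseteq> V"
  shows "corridor d m (\<lambda>i. g ` F i)"
proof
  have inter: "card (g ` F i \<inter> g ` F j) = card (F i \<inter> F j)" if "i \<le> m" "j \<le> m" for i j
  proof -
    have "g ` F i \<inter> g ` F j = g ` (F i \<inter> F j)"
      using assms that by (simp add: inj_on_image_Int)
    moreover have "inj_on g (F i \<inter> F j)"
      using assms that by (meson inf_le1 inj_on_subset order_trans)
    ultimately show ?thesis by (simp add: card_image)
  qed
  show "i \<le> m \<Longrightarrow> card (g ` F i) = d" for i using inter[of i i] card_facet[of i] by simp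
  show "i < m \<Longrightarrow> card (g ` F i \<inter> g ` F (Suc i)) = d - 1" for i
    using inter[of i "Suc i"] card_consecutive[of i] by simp
  show "Suc i < j \<Longrightarrow> j \<le> m \<Longrightarrow> card (g ` F i \<inter> g ` F j) < d - 1" for i j
    using inter[of i j] card_nonconsecutive[of i j] by simp
qed (rule d_gt_1)

theorem theorem1p6:
  fixes d n :: nat and V :: "'a set" and C :: "'a set set" and \<delta> :: ereal
  assumes "d \<ge> 2"
    and "pure_complex d V C"
    and "strongly_connected_complex d C"
    and "card V = n"
    and "complex_diameter d C = \<delta>"
  shows "\<exists>(W :: nat set) K. pseudo_manifold_without_boundary d W K \<and> card W = 2 * n
           \<and> complex_diameter d K \<ge> \<delta> + 2"
proof -
  have "1 < d" using assms(1) by simp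
  then obtain m F where F: "corridor d m F" "\<And>i. i \<le> m \<Longrightarrow> F i \<in> C" and
    "complex_diameter d C \<le> ereal (real m)"
    using diameter_corridor[OF _ assms(2,3)] by blast
  then have "\<delta> + 2 \<le> ereal (real m) + 2" using assms(5) by (intro add_right_mono) simp
  then have \<delta>: "\<delta> + 2 \<le> ereal (real (m + 2))" by (simp add: add.commute)
  interpret corridor d m F by (rule F(1))
  have "finite V" and FV: "\<And>i. i \<le> m \<Longrightarrow> F i \<subseteq> V"
    using assms(2) F(2) by (auto simp: pure_complex_def)
  show ?thesis
  \<comment> \<open>For \<open>d = 2\<close> and \<open>m > 0\<close> the height bound
    \<open>m + d - 1\<close> is only \<open>m + 1\<close>, so the polygon takes over.\<close>
  proof (cases "d = 2")
    case True
    have "card (\<Union>i\<le>m. F i) \<le> n"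
      unfolding assms(4)[symmetric] using FV by (intro card_mono[OF \<open>finite V\<close>]) auto
    then have n: "m + 2 \<le> n" using card_Union_facets[OF True, of m] by simp
    then have "\<delta> + 2 \<le> ereal (real n)"
      using \<delta> by (metis ereal_less_eq(3) of_nat_mono order_trans)
    also have "\<dots> \<le> complex_diameter d (polygon (2 * n))"
      using diameter_polygon[of n] n True by simp
    finally have "\<delta> + 2 \<le> complex_diameter d (polygon (2 * n))" .
    moreover have "pseudo_manifold_without_boundary d {..<2 * n} (polygon (2 * n))"
      using n True unfolding pseudo_manifold_without_boundary_def
      by (simp add: pure_complex_polygon strongly_connected_polygon card_polygon_over_vertex)
    ultimately show ?thesis by (metis card_lessThan)
  next
    case False
    \<comment> \<open>Numbering \<open>V\<close> by \<open>{..<n}\<close> places all lifts inside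
      \<open>{..<2 * n}\<close>; points outside the corridor stay in the ground set without lying on
      a facet.\<close>
    obtain g where g: "bij_betw g V {..<n}"
      using ex_bij_betw_finite_nat[OF \<open>finite V\<close>] assms(4) by (auto simp: atLeast0LessThan)
    interpret N: nat_corridor d m "\<lambda>i. g ` F i"
      unfolding nat_corridor_def
      using corridor_image[OF bij_betw_imp_inj_on[OF g] FV] by simp
    have "g ` F i \<subseteq> {..<n}" if "i \<le> m" for i
      using FV[OF that] g by (auto simp: bij_betw_def)
    then have "pseudo_manifold_without_boundary d {..<2 * n} N.double"
      unfolding pseudo_manifold_without_boundary_def
      by (simp add: N.pure_complex_double N.strongly_connected_double N.card_double_over_ridge)
    moreover have "\<delta> + 2 \<le> complex_diameter d N.double"
      using N.diameter_double False \<open>1 < d\<close> by (intro order_trans[OF \<delta>]) simp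
    ultimately show ?thesis by (metis card_lessThan)
  qed
qed

end
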